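(* Let $T>0$, let $\rho\in C([0,T];\mathcal P_2(\mathbb R^d))$, and suppose $V_1$ satisfies (V1) and (V2). There exists a constant $C$ depending on $V_1$ such that, for every $\varepsilon>0$ and every $\varphi\in C^2_c([0,T]\times\mathbb R^d)$, $$\left\|\mathbf 1_{\{V_\varepsilon*\rho>0\}}\,\frac{V_\varepsilon*(\nabla\varphi\,\rho)-\nabla\varphi\,(V_\varepsilon*\rho)}{\sqrt{V_\varepsilon*\rho}}\right\|_{L^2([0,T]\times\mathbb R^d)}\le\varepsilon\,C\,\|D^2\varphi\|_{L^2([0,T];L^\infty(\mathbb R^d))}.$$
   Context: $\mathcal P_2(\mathbb R^d)$ is the set of Borel probability measures on $\mathbb R^d$ with finite second moment, equipped with the 2-Wasserstein distance. $B_1$ is the closed unit ball centred at $0$. $\langle x\rangle:=\sqrt{1+|x|^2}$ and, for $p=1,2$, $\mathcal N_p(x):=Z^{-1}\exp(-\langle x\rangle^p)$ with $Z$ the normalising constant so that $\int\mathcal N_p\,dx=1$. (V1): $V_1\in C_b(\mathbb R^d)\cap C^1(\mathbb R^d)$, $V_1\ge0$, $\|V_1\|_{L^1}=1$, $V_1(x)=V_1(-x)$. (V2): either $\operatorname{supp}V_1\subset B_1$, or $V_1=\mathcal N_p$ with $p=1$ or $p=2$. $V_\varepsilon(x):=\varepsilon^{-d}V_1(x/\varepsilon)$. $\nabla$ and $D^2$ act on the space variable $x$; convolutions are in $x$, e.g. $V_\varepsilon*(\nabla\varphi\,\rho)(t,x)=\int V_\varepsilon(x-y)\nabla\varphi(t,y)\,d\rho_t(y)$.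 *)

theory Defs
  imports "HOL-Analysis.Analysis" "HOL-Probability.Probability"
begin

text \<open>The space \<open>R^d\<close> is a type \<open>'a::euclidean_space\<close> with \<open>d = DIM('a)\<close>.\<close>

section \<open>Wasserstein space\<close>

definition P2 :: "'a::euclidean_space measure set" where
  "P2 = {\<mu>. sets \<mu> = sets borel \<and> prob_space \<mu> \<and> integrable \<mu> (\<lambda>x. (norm x)\<^sup>2)}"

definition couplings ::
    "'a::euclidean_space measure \<Rightarrow> 'a measure \<Rightarrow> ('a \<times> 'a) measure set" where
  "couplings \<mu> \<nu> =
     {\<pi>. sets \<pi> = sets borel \<and> distr \<pi> borel fst = \<mu> \<and> distr \<pi> borel snd = \<nu>}"

text \<open>The infimum is finite for measures in \<open>P2\<close>, so \<open>enn2real\<close> loses nothing there.\<close>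

definition W2 :: "'a::euclidean_space measure \<Rightarrow> 'a measure \<Rightarrow> real" where
  "W2 \<mu> \<nu> =
     sqrt (enn2real (INF \<pi>\<in>couplings \<mu> \<nu>. \<integral>\<^sup>+z. ennreal ((dist (fst z) (snd z))\<^sup>2) \<partial>\<pi>))"

definition P2_curve :: "real \<Rightarrow> (real \<Rightarrow> 'a::euclidean_space measure) \<Rightarrow> bool" where
  "P2_curve T \<rho> \<longleftrightarrow>
     (\<forall>t\<in>{0..T}. \<rho> t \<in> P2) \<and>
     (\<forall>t\<in>{0..T}. ((\<lambda>s. W2 (\<rho> s) (\<rho> t)) \<longlongrightarrow> 0) (at t within {0..T}))"

section \<open>The mollifier\<close>

definition bracket :: "'a::euclidean_space \<Rightarrow> real" where
  "bracket x = sqrt (1 + (norm x)\<^sup>2)"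

definition Np :: "nat \<Rightarrow> 'a::euclidean_space \<Rightarrow> real" where
  "Np p x = exp (- (bracket x ^ p)) / (LINT y|lborel. exp (- (bracket (y::'a) ^ p)))"

definition V1_regular :: "('a::euclidean_space \<Rightarrow> real) \<Rightarrow> bool" where
  "V1_regular V \<longleftrightarrow>
     continuous_on UNIV V \<and> bounded (range V) \<and>
     (\<exists>G. (\<forall>x. GDERIV V x :> G x) \<and> continuous_on UNIV G) \<and>
     (\<forall>x. V x \<ge> 0) \<and>
     integrable lborel V \<and> (LINT x|lborel. \<bar>V x\<bar>) = 1 \<and>
     (\<forall>x. V x = V (- x))"

definition V2_shape :: "('a::euclidean_space \<Rightarrow> real) \<Rightarrow> bool" where
  "V2_shape V \<longleftrightarrow> closure {x. V x \<noteq> 0} \<subseteq> cball 0 1 \<or> V = Np 1 \<or> V = Np 2"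

definition rescale :: "real \<Rightarrow> ('a::euclidean_space \<Rightarrow> real) \<Rightarrow> 'a \<Rightarrow> real" where
  "rescale \<epsilon> V x = V (x /\<^sub>R \<epsilon>) / \<epsilon> ^ DIM('a)"

text \<open>Convolution \<open>V * (f \<mu>)\<close> of a scalar kernel with the measure of (vector-valued)
  density \<open>f\<close> with respect to \<open>\<mu>\<close>.\<close>

definition conv ::
    "('a::euclidean_space \<Rightarrow> real) \<Rightarrow> ('a \<Rightarrow> 'b::euclidean_space) \<Rightarrow> 'a measure \<Rightarrow> 'a \<Rightarrow> 'b" where
  "conv V f \<mu> x = (LINT y|\<mu>. V (x - y) *\<^sub>R f y)"

section \<open>Test functions\<close>

text \<open>At points of the boundary of \<open>S\<close> derivatives are taken within \<open>S\<close>; for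
  \<open>S = {0..T} \<times> UNIV\<close> with \<open>T > 0\<close> these are unique.\<close>

definition C2_on ::
    "'b::real_normed_vector set \<Rightarrow> ('b \<Rightarrow> real) \<Rightarrow> bool" where
  "C2_on S f \<longleftrightarrow>
     (\<exists>(f' :: 'b \<Rightarrow> 'b \<Rightarrow>\<^sub>L real) (f'' :: 'b \<Rightarrow> 'b \<Rightarrow>\<^sub>L 'b \<Rightarrow>\<^sub>L real).
        (\<forall>z\<in>S. (f has_derivative blinfun_apply (f' z)) (at z within S)) \<and>
        (\<forall>z\<in>S. (f' has_derivative blinfun_apply (f'' z)) (at z within S)) \<and>
        continuous_on S f'')"

definition C2_compact :: "real \<Rightarrow> (real \<times> 'a::euclidean_space \<Rightarrow> real) \<Rightarrow> bool" where
  "C2_compact T \<phi> \<longleftrightarrow>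
     C2_on ({0..T} \<times> UNIV) \<phi> \<and> compact (closure {z \<in> {0..T} \<times> UNIV. \<phi> z \<noteq> 0})"

definition grad :: "('a::euclidean_space \<Rightarrow> real) \<Rightarrow> 'a \<Rightarrow> 'a" where
  "grad f x = (THE D. GDERIV f x :> D)"

definition hess :: "('a::euclidean_space \<Rightarrow> real) \<Rightarrow> 'a \<Rightarrow> 'a \<Rightarrow>\<^sub>L 'a" where
  "hess f x = Blinfun (frechet_derivative (grad f) (at x))"

section \<open>Lebesgue norms\<close>

text \<open>\<open>L2_norm\<close> is only meaningful together with \<open>in_L2\<close>: a Bochner integral that does not
  exist is \<open>0\<close>. Likewise \<open>Linf_norm\<close> is meaningful for essentially bounded measurable
  functions on a space of nonzero measure.\<close>

definition in_L2 :: "'c measure \<Rightarrow> ('c \<Rightarrow> 'b::real_normed_vector) \<Rightarrow> bool" where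
  "in_L2 M f \<longleftrightarrow> f \<in> borel_measurable M \<and> integrable M (\<lambda>x. (norm (f x))\<^sup>2)"

definition L2_norm :: "'c measure \<Rightarrow> ('c \<Rightarrow> 'b::real_normed_vector) \<Rightarrow> real" where
  "L2_norm M f = sqrt (LINT x|M. (norm (f x))\<^sup>2)"

definition Linf_norm :: "'c measure \<Rightarrow> ('c \<Rightarrow> 'b::real_normed_vector) \<Rightarrow> real" where
  "Linf_norm M f = real_of_ereal (esssup M (\<lambda>x. ereal (norm (f x))))"

section \<open>The commutator\<close>

definition commutator ::
    "('a::euclidean_space \<Rightarrow> real) \<Rightarrow> (real \<Rightarrow> 'a measure) \<Rightarrow> (real \<times> 'a \<Rightarrow> real) \<Rightarrow>
      real \<times> 'a \<Rightarrow> 'a" where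
  "commutator V \<rho> \<phi> = (\<lambda>(t, x).
     let V\<rho> = conv V (\<lambda>_. 1::real) (\<rho> t) x;
         D\<phi> = grad (\<lambda>y. \<phi> (t, y))
     in (if V\<rho> > 0 then (conv V D\<phi> (\<rho> t) x - V\<rho> *\<^sub>R D\<phi> x) /\<^sub>R sqrt V\<rho> else 0))"

end

theory Submission
  imports Defs
begin

text \<open>
  Write \<open>k = V\<^sub>\<epsilon>\<close> and \<open>H t\<close> for the sup norm of the Hessian of \<open>\<phi> t\<close>. By the mean value inequality the
  numerator of the commutator is at most \<open>H t\<close> times the integral of \<open>k (x - y) |x - y|\<close> against
  \<open>\<rho> t\<close>. By the Cauchy-Schwarz inequality for the measure \<open>k (x - y) d\<rho> t(y)\<close>, whose mass cancels
  the denominator, the square of the commutator is at most \<open>(H t)\<^sup>2\<close> times the integral of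
  \<open>k (x - y) |x - y|\<^sup>2\<close>. Integrating in \<open>x\<close> and using that \<open>\<rho> t\<close> is a probability measure leaves
  \<open>\<epsilon>\<^sup>2 M (H t)\<^sup>2\<close>, where \<open>M\<close> is the second moment of \<open>V\<^sub>1\<close>; hence \<open>C = sqrt M\<close>.
\<close>

section \<open>Slices of test functions\<close>

text \<open>\<open>grad\<close> is a definite description, so computing it requires uniqueness: the
  derivative functional determines its representing vector.\<close>

lemma grad_eqI:
  assumes "GDERIV f x :> D"
  shows "grad f x = D"
proof -
  have "D' = D" if "GDERIV f x :> D'" for D'
  proof -
    have "(\<lambda>h. inner h D') = (\<lambda>h. inner h D)"
      using that assms unfolding gderiv_def by (rule has_derivative_unique)
    then show ?thesis by (metis vector_eq_ldot)
  qed
  then show ?thesis unfolding grad_def using assms by (rule the_equality[rotated])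
qed

lemma hess_eqI:
  assumes "(grad f has_derivative h) (at x)"
  shows "blinfun_apply (hess f x) = h"
  using assms frechet_derivative_at[OF assms]
  by (simp add: hess_def bounded_linear_Blinfun_apply has_derivative_bounded_linear)

text \<open>The slice at \<open>t\<close> lies in the strip and has no boundary in the space
  directions. Hence, even when \<open>t\<close> is an endpoint, a derivative within the strip
  restricts to a full derivative in \<open>x\<close>.\<close>

lemma has_derivative_slice:
  assumes "(f has_derivative f') (at (t, x) within I \<times> UNIV)" "t \<in> I"
  shows "((\<lambda>y. f (t, y)) has_derivative (\<lambda>h. f' (0, h))) (at x)"
proof -
  have "((\<lambda>y. (t, y)) has_derivative (\<lambda>h. (0, h))) (at x)"
    by (auto intro!: derivative_eq_intros)
  moreover have "(f has_derivative f') (at (t, x) within (\<lambda>y. (t, y)) ` UNIV)"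
    by (rule has_derivative_subset[OF assms(1)]) (use assms(2) in auto)
  ultimately show ?thesis
    using has_derivative_in_compose[of "\<lambda>y. (t, y)" "\<lambda>h. (0, h)" x UNIV f f'] by simp
qed

text \<open>\<open>C2_on\<close> provides derivatives jointly in time and space. Setting the time
  component of the direction to \<open>0\<close> and representing the remaining functional by a
  vector expresses gradient and Hessian through \<open>f'\<close> and \<open>f''\<close>, whose
  regularity they inherit.\<close>

lemma C2_on_slices:
  fixes \<phi> :: "real \<times> 'a::euclidean_space \<Rightarrow> real"
  assumes "C2_on (I \<times> UNIV) \<phi>"
  shows continuous_on_grad_slice:
      "continuous_on (I \<times> UNIV) (\<lambda>(t, x). grad (\<lambda>y. \<phi> (t, y)) x)"
    and has_derivative_grad_slice:
      "\<And>t x. t \<in> I \<Longrightarrow> (grad (\<lambda>y. \<phi> (t, y)) has_derivative hess (\<lambda>y. \<phi> (t, y)) x) (at x)"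
    and continuous_on_hess_slice:
      "continuous_on (I \<times> UNIV) (\<lambda>(t, x). hess (\<lambda>y. \<phi> (t, y)) x)"
proof -
  let ?S = "I \<times> (UNIV :: 'a set)"
  obtain f' f'' where f': "\<And>z. z \<in> ?S \<Longrightarrow> (\<phi> has_derivative blinfun_apply (f' z)) (at z within ?S)"
    and f'': "\<And>z. z \<in> ?S \<Longrightarrow> (f' has_derivative blinfun_apply (f'' z)) (at z within ?S)"
    and cont: "continuous_on ?S f''"
    using assms unfolding C2_on_def by metis
  \<comment> \<open>\<open>g z\<close> is the Riesz vector of the functional sending
    \<open>h\<close> to \<open>f' z (0, h)\<close>; \<open>H z w\<close> is the derivative of
    \<open>g\<close> at \<open>z\<close> in the space-time direction \<open>w\<close>.\<close>
  define g where "g z = (\<Sum>b\<in>Basis. f' z (0, b) *\<^sub>R (b :: 'a))" for z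
  define H where "H z w = (\<Sum>b\<in>Basis. f'' z w (0, b) *\<^sub>R (b :: 'a))" for z w
  have inner_g: "inner h (g z) = f' z (0, h)" for h z
  proof -
    have "linear (\<lambda>h. f' z (0, h))"
      by (rule linearI) (simp_all flip: blinfun.add_right real_scaleR_def blinfun.scaleR_right)
    then have "f' z (0, h) = (\<Sum>b\<in>Basis. inner h b *\<^sub>R f' z (0, b))"
      using linear_sum[of "\<lambda>h. f' z (0, h)" "\<lambda>b. inner h b *\<^sub>R b" Basis]
        linear_scale[of "\<lambda>h. f' z (0, h)"]
      by (simp add: euclidean_representation)
    then show ?thesis
      by (simp add: g_def inner_sum_right mult.commute)
  qed
  have grad: "grad (\<lambda>y. \<phi> (t, y)) x = g (t, x)" if "t \<in> I" for t x
    using has_derivative_slice[OF f'] that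
    by (intro grad_eqI) (auto simp: gderiv_def inner_g)
  have dg: "(g has_derivative H z) (at z within ?S)" if "z \<in> ?S" for z
    unfolding g_def H_def
    by (intro has_derivative_sum has_derivative_scaleR_left
        bounded_linear.has_derivative[OF blinfun.bounded_linear_left f''] that)
  have "continuous_on ?S g"
    unfolding continuous_on_eq_continuous_within by (intro ballI has_derivative_continuous[OF dg])
  then show "continuous_on ?S (\<lambda>(t, x). grad (\<lambda>y. \<phi> (t, y)) x)"
    by (rule continuous_on_eq) (auto simp: grad)
  have dgrad: "(grad (\<lambda>y. \<phi> (t, y)) has_derivative (\<lambda>h. H (t, x) (0, h))) (at x)"
    if "t \<in> I" for t x
  proof -
    have "grad (\<lambda>y. \<phi> (t, y)) = (\<lambda>y. g (t, y))" using that by (auto simp: grad)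
    then show ?thesis using has_derivative_slice[OF dg] that by auto
  qed
  note hess = hess_eqI[OF dgrad]
  show "(grad (\<lambda>y. \<phi> (t, y)) has_derivative hess (\<lambda>y. \<phi> (t, y)) x) (at x)" if "t \<in> I" for t x
    using dgrad[OF that] hess[OF that] by simp
  show "continuous_on ?S (\<lambda>(t, x). hess (\<lambda>y. \<phi> (t, y)) x)"
  \<comment> \<open>In finite dimension, continuity in the operator norm can be tested on basis
    vectors.\<close>
  proof (rule continuous_on_blinfun_componentwise)
    fix i :: 'a
    have "continuous_on ?S (\<lambda>z. H z (0, i))"
      unfolding H_def by (intro continuous_intros cont)
    then show "continuous_on ?S (\<lambda>z. (case z of (t, x) \<Rightarrow> hess (\<lambda>y. \<phi> (t, y)) x) i)"
      by (rule continuous_on_eq) (auto simp: hess)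
  qed
qed

section \<open>Boundedness of gradients and Hessians of compactly supported functions\<close>

lemma bounded_image_if_compact_support:
  assumes "continuous_on S f" "compact K" "K \<subseteq> S" "\<And>z. z \<in> S - K \<Longrightarrow> f z = 0"
  shows "bounded (f ` S)"
proof -
  have "bounded (insert 0 (f ` K))"
    using compact_imp_bounded[OF compact_continuous_image[OF continuous_on_subset[OF assms(1,3)] assms(2)]]
    by simp
  then show ?thesis
    by (rule bounded_subset) (use assms(4) in auto)
qed

text \<open>Off the support \<open>K\<close> the function vanishes near every point of a slice, so
  its gradient and then its Hessian vanish there; on the compact set \<open>K\<close> both are
  continuous.\<close>

lemma C2_compact_bounded_slices:
  fixes \<phi> :: "real \<times> 'a::euclidean_space \<Rightarrow> real"
  assumes "C2_compact T \<phi>"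
  shows bounded_grad_slice:
      "bounded ((\<lambda>(t, x). grad (\<lambda>y. \<phi> (t, y)) x) ` ({0..T} \<times> UNIV))"
    and bounded_hess_slice:
      "bounded ((\<lambda>(t, x). hess (\<lambda>y. \<phi> (t, y)) x) ` ({0..T} \<times> UNIV))"
proof -
  let ?S = "{0..T} \<times> (UNIV :: 'a set)"
  define K where "K = closure {z \<in> ?S. \<phi> z \<noteq> 0}"
  have C2: "C2_on ?S \<phi>" and K: "compact K" "closed K"
    using assms by (auto simp: C2_compact_def K_def)
  have KS: "K \<subseteq> ?S"
    unfolding K_def by (rule closure_minimal) (auto intro: closed_Times)
  have zero: "\<phi> z = 0" if "z \<in> ?S - K" for z
    using that subsetD[OF closure_subset, of z "{z \<in> ?S. \<phi> z \<noteq> 0}"] unfolding K_def by auto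
  \<comment> \<open>Derivatives are taken at frozen \<open>t\<close>, so openness within the slice
    is enough for vanishing to pass to them.\<close>
  have opn: "open {y. (t, y) \<notin> K}" for t
  proof -
    have "{y. (t, y) \<notin> K} = (\<lambda>y. (t, y)) -` (- K)" by auto
    then show ?thesis using K(2) by (simp add: open_vimage open_Compl continuous_on_Pair)
  qed
  have grad0: "grad (\<lambda>y. \<phi> (t, y)) x = 0" if "t \<in> {0..T}" "(t, x) \<notin> K" for t x
  proof -
    have "((\<lambda>y. \<phi> (t, y)) has_derivative (\<lambda>h. 0)) (at x)"
      by (rule has_derivative_transform_within_open[OF has_derivative_const[of 0] opn[of t]])
        (use that zero in auto)
    then show ?thesis by (intro grad_eqI) (simp add: gderiv_def)
  qed
  have hess0: "hess (\<lambda>y. \<phi> (t, y)) x = 0" if "t \<in> {0..T}" "(t, x) \<notin> K" for t x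
  proof -
    have "(grad (\<lambda>y. \<phi> (t, y)) has_derivative (\<lambda>h. 0)) (at x)"
      by (rule has_derivative_transform_within_open[OF has_derivative_const[of 0] opn[of t]])
        (use that grad0 in auto)
    from hess_eqI[OF this] show ?thesis by (intro blinfun_eqI) simp
  qed
  show "bounded ((\<lambda>(t, x). grad (\<lambda>y. \<phi> (t, y)) x) ` ?S)"
    by (rule bounded_image_if_compact_support[OF continuous_on_grad_slice[OF C2] K(1) KS])
      (auto simp: grad0)
  show "bounded ((\<lambda>(t, x). hess (\<lambda>y. \<phi> (t, y)) x) ` ?S)"
    by (rule bounded_image_if_compact_support[OF continuous_on_hess_slice[OF C2] K(1) KS])
      (auto simp: hess0)
qed

text \<open>A closed set of full Lebesgue measure is the whole space. Applied to the points where
  \<open>norm (f x)\<close> is at most its essential supremum, this turns the almost everywhere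
  bound into a pointwise one.\<close>

lemma Linf_norm_le_iff:
  fixes f :: "'a::euclidean_space \<Rightarrow> 'b::real_normed_vector"
  assumes "continuous_on UNIV f" "bounded (range f)"
  shows "Linf_norm lborel f \<le> a \<longleftrightarrow> (\<forall>x. norm (f x) \<le> a)"
proof -
  let ?E = "esssup lborel (\<lambda>x. ereal (norm (f x)))"
  have meas: "(\<lambda>x. ereal (norm (f x))) \<in> borel_measurable lborel"
    using assms(1) by (auto intro!: borel_measurable_ereal borel_measurable_continuous_onI continuous_intros)
  obtain B where B: "\<And>x. norm (f x) \<le> B" using assms(2) by (auto simp: bounded_iff)
  have le: "?E \<le> ereal c" if "\<And>x. norm (f x) \<le> c" for c
    using that by (intro esssup_I meas) auto
  have ptw: "ereal (norm (f x)) \<le> ?E" for x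
  proof -
    have cl: "closed {x. ereal (norm (f x)) \<le> ?E}"
      using assms(1) by (intro closed_Collect_le continuous_intros continuous_on_ereal)
    have "AE x in lebesgue. x \<in> {x. ereal (norm (f x)) \<le> ?E}"
      using AE_completion[OF esssup_AE[of "\<lambda>x. ereal (norm (f x))" lborel]] by simp
    from mem_closed_if_AE_lebesgue[OF cl this] show ?thesis by simp
  qed
  \<comment> \<open>The value at \<open>0\<close> and the bound \<open>B\<close> keep
    \<open>?E\<close> finite, so \<open>real_of_ereal\<close> does not fall back to its default
    \<open>0\<close>.\<close>
  have "0 \<le> ?E" using ptw[of 0] norm_ge_zero[of "f 0"] by (metis ereal_less_eq(5) order_trans)
  moreover have "?E < \<infinity>" using le[OF B] by (rule order_le_less_trans) simp
  ultimately obtain e where e: "?E = ereal e" by (cases ?E) auto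
  then have "Linf_norm lborel f = e" by (simp add: Linf_norm_def)
  with ptw le[of a] show ?thesis by (auto simp: e intro: order_trans)
qed

section \<open>Wasserstein continuous curves as kernels\<close>

text \<open>Pushing \<open>L x\<close> forward along the map from \<open>y\<close> to
  \<open>(x, y)\<close> removes the parameter from the integrand, leaving one fixed function
  integrated against a measurable kernel.\<close>

lemma integral_measurable_subprob_algebra2:
  fixes f :: "'a \<Rightarrow> 'b \<Rightarrow> 'c::{banach, second_countable_topology}"
  assumes f[measurable]: "(\<lambda>(x, y). f x y) \<in> borel_measurable (M \<Otimes>\<^sub>M N)"
  assumes L[measurable]: "L \<in> measurable M (subprob_algebra N)"
  shows "(\<lambda>x. integral\<^sup>L (L x) (f x)) \<in> borel_measurable M"
proof -
  note measurable_distr2[measurable]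
  have "(\<lambda>x. integral\<^sup>L (distr (L x) (M \<Otimes>\<^sub>M N) (\<lambda>y. (x, y))) (\<lambda>(x, y). f x y)) \<in> borel_measurable M"
    by measurable
  also have "?this \<longleftrightarrow> (\<lambda>x. integral\<^sup>L (L x) (f x)) \<in> borel_measurable M"
    by (rule measurable_cong) (subst integral_distr; auto simp: measurable_Pair1' sets_kernel[OF L] cong: measurable_cong_sets)
  finally show ?thesis .
qed

section \<open>Couplings and the Wasserstein distance\<close>

lemma P2D:
  assumes "\<mu> \<in> P2"
  shows "sets \<mu> = sets borel" "prob_space \<mu>" "integrable \<mu> (\<lambda>x. (norm x)\<^sup>2)"
  using assms by (simp_all add: P2_def)

lemma couplingsD:
  fixes \<mu> :: "'a::euclidean_space measure"
  assumes "\<pi> \<in> couplings \<mu> \<nu>"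
  shows "sets \<pi> = sets (borel \<Otimes>\<^sub>M borel)" "distr \<pi> borel fst = \<mu>" "distr \<pi> borel snd = \<nu>"
  using assms unfolding couplings_def borel_prod by simp_all

lemma couplings_prob_space:
  fixes \<mu> :: "'a::euclidean_space measure"
  assumes "\<pi> \<in> couplings \<mu> \<nu>" "prob_space \<mu>"
  shows "prob_space \<pi>"
proof (rule prob_space_distrD)
  note [measurable_cong] = couplingsD(1)[OF assms(1)]
  show "fst \<in> measurable \<pi> borel" by measurable
  show "prob_space (distr \<pi> borel fst)"
    using assms(2) by (simp add: couplingsD(2)[OF assms(1)])
qed

text \<open>The inequality \<open>(a + b)^2 <= 2 a^2 + 2 b^2\<close> bounds the cost by the second
  moments of the marginals. Finiteness matters because \<open>W2\<close> applies
  \<open>enn2real\<close>, which sends infinity to \<open>0\<close>.\<close>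

lemma couplings_cost_finite:
  fixes \<mu> \<nu> :: "'a::euclidean_space measure"
  assumes "\<mu> \<in> P2" "\<nu> \<in> P2" "\<pi> \<in> couplings \<mu> \<nu>"
  shows "(\<integral>\<^sup>+z. ennreal ((dist (fst z) (snd z))\<^sup>2) \<partial>\<pi>) < \<infinity>"
proof -
  have fin: "(\<integral>\<^sup>+x. ennreal ((norm x)\<^sup>2) \<partial>m) < \<infinity>" if "m \<in> P2" for m :: "'a measure"
    using integrableD(2)[OF P2D(3)[OF that]] by (simp add: less_top)
  note [measurable_cong] = couplingsD(1)[OF assms(3)]
  note \<pi> = couplingsD(2,3)[OF assms(3)]
  have "(\<integral>\<^sup>+z. ennreal ((dist (fst z) (snd z))\<^sup>2) \<partial>\<pi>)
      \<le> (\<integral>\<^sup>+z. 2 * ennreal ((norm (fst z))\<^sup>2) + 2 * ennreal ((norm (snd z))\<^sup>2) \<partial>\<pi>)"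
  proof (intro nn_integral_mono)
    fix z :: "'a \<times> 'a"
    have "(dist (fst z) (snd z))\<^sup>2 \<le> (norm (fst z) + norm (snd z))\<^sup>2"
      by (intro power_mono) (auto simp: dist_norm norm_triangle_ineq4)
    also have "\<dots> \<le> 2 * (norm (fst z))\<^sup>2 + 2 * (norm (snd z))\<^sup>2"
      using sum_squares_bound[of "norm (fst z)" "norm (snd z)"] by (simp add: power2_sum)
    finally have "ennreal ((dist (fst z) (snd z))\<^sup>2)
        \<le> ennreal (2 * (norm (fst z))\<^sup>2 + 2 * (norm (snd z))\<^sup>2)"
      by (rule ennreal_leI)
    also have "\<dots> = 2 * ennreal ((norm (fst z))\<^sup>2) + 2 * ennreal ((norm (snd z))\<^sup>2)"
      by (simp add: ennreal_plus ennreal_mult)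
    finally show "ennreal ((dist (fst z) (snd z))\<^sup>2)
        \<le> 2 * ennreal ((norm (fst z))\<^sup>2) + 2 * ennreal ((norm (snd z))\<^sup>2)" .
  qed
  also have "\<dots> = 2 * (\<integral>\<^sup>+z. ennreal ((norm (fst z))\<^sup>2) \<partial>\<pi>) + 2 * (\<integral>\<^sup>+z. ennreal ((norm (snd z))\<^sup>2) \<partial>\<pi>)"
    by (simp add: nn_integral_add nn_integral_cmult)
  also have "\<dots> = 2 * (\<integral>\<^sup>+x. ennreal ((norm x)\<^sup>2) \<partial>\<mu>) + 2 * (\<integral>\<^sup>+x. ennreal ((norm x)\<^sup>2) \<partial>\<nu>)"
    unfolding \<pi>[symmetric] by (simp add: nn_integral_distr)
  also have "\<dots> < \<infinity>"
    using fin[OF assms(1)] fin[OF assms(2)] by (simp add: ennreal_mult_less_top)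
  finally show ?thesis .
qed

text \<open>The product coupling shows that the infimum in \<open>W2\<close> ranges over a nonempty
  set.\<close>

lemma pair_measure_in_couplings:
  fixes \<mu> \<nu> :: "'a::euclidean_space measure"
  assumes "\<mu> \<in> P2" "\<nu> \<in> P2"
  shows "\<mu> \<Otimes>\<^sub>M \<nu> \<in> couplings \<mu> \<nu>"
proof -
  interpret \<mu>: prob_space \<mu> by (rule P2D[OF assms(1)])
  interpret \<nu>: prob_space \<nu> by (rule P2D[OF assms(2)])
  interpret pair_sigma_finite \<mu> \<nu> ..
  note sets_eq = P2D(1)[OF assms(1)] P2D(1)[OF assms(2)]
  have s: "sets (\<mu> \<Otimes>\<^sub>M \<nu>) = sets borel"
    by (simp add: sets_eq flip: borel_prod cong: sets_pair_measure_cong)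
  have 1: "distr (\<mu> \<Otimes>\<^sub>M \<nu>) borel fst = \<mu>"
  proof -
    have "distr (\<mu> \<Otimes>\<^sub>M \<nu>) borel fst = distr (\<mu> \<Otimes>\<^sub>M \<nu>) \<mu> fst"
      by (rule distr_cong) (simp_all add: sets_eq)
    then show ?thesis by (simp add: \<nu>.distr_pair_fst)
  qed
  \<comment> \<open>The second marginal becomes a first marginal after swapping the factors.\<close>
  have "distr (\<mu> \<Otimes>\<^sub>M \<nu>) borel snd = distr (distr (\<nu> \<Otimes>\<^sub>M \<mu>) (\<mu> \<Otimes>\<^sub>M \<nu>) (\<lambda>(x, y). (y, x))) \<nu> snd"
    by (subst (1) distr_pair_swap) (rule distr_cong; simp add: sets_eq)
  also have "\<dots> = distr (\<nu> \<Otimes>\<^sub>M \<mu>) \<nu> fst"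
    by (subst distr_distr) (auto simp: comp_def split_beta intro!: distr_cong)
  also have "\<dots> = \<nu>" by (rule \<mu>.distr_pair_fst)
  finally show ?thesis using s 1 by (simp add: couplings_def)
qed

text \<open>Under any coupling the difference is the integral of
  \<open>f (fst z) - f (snd z)\<close>, at most \<open>L\<close> times the mean distance;
  Cauchy-Schwarz against a constant passes to the mean squared distance. This is the easy half of
  Kantorovich duality.\<close>

lemma lipschitz_integral_diff_le_W2:
  fixes \<mu> \<nu> :: "'a::euclidean_space measure" and f :: "'a \<Rightarrow> real"
  assumes P2: "\<mu> \<in> P2" "\<nu> \<in> P2"
    and lip: "\<And>x y. \<bar>f x - f y\<bar> \<le> L * dist x y" and L: "L > 0"
    and f: "f \<in> borel_measurable borel" and bdd: "\<And>x. \<bar>f x\<bar> \<le> B"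
  shows "\<bar>(LINT x|\<mu>. f x) - (LINT x|\<nu>. f x)\<bar> \<le> L * W2 \<mu> \<nu>"
proof -
  note [measurable] = f
  let ?D = "\<bar>(LINT x|\<mu>. f x) - (LINT x|\<nu>. f x)\<bar>"
  let ?I = "INF \<pi>\<in>couplings \<mu> \<nu>. \<integral>\<^sup>+z. ennreal ((dist (fst z) (snd z))\<^sup>2) \<partial>\<pi>"
  \<comment> \<open>The bound is kept squared and divided by \<open>L^2\<close>, so that the infimum
    over couplings can be taken before the root.\<close>
  have "ennreal ((?D / L)\<^sup>2) \<le> (\<integral>\<^sup>+z. ennreal ((dist (fst z) (snd z))\<^sup>2) \<partial>\<pi>)"
    if \<pi>: "\<pi> \<in> couplings \<mu> \<nu>" for \<pi>
  proof -
    interpret prob_space \<pi> by (rule couplings_prob_space[OF \<pi> P2D(2)[OF P2(1)]])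
    note [measurable_cong] = couplingsD(1)[OF \<pi>]
    note marg = couplingsD(2,3)[OF \<pi>]
    have i: "integrable \<pi> (\<lambda>z. f (fst z))" "integrable \<pi> (\<lambda>z. f (snd z))"
      by (rule integrable_const_bound[of _ B]; simp add: bdd)+
    have "ennreal ?D = ennreal (norm (LINT z|\<pi>. f (fst z) - f (snd z)))"
      unfolding marg[symmetric] by (simp add: integral_distr i)
    also have "\<dots> \<le> (\<integral>\<^sup>+z. norm (f (fst z) - f (snd z)) \<partial>\<pi>)"
      by (intro integral_norm_bound_ennreal Bochner_Integration.integrable_diff i)
    also have "\<dots> \<le> (\<integral>\<^sup>+z. ennreal L * ennreal (dist (fst z) (snd z)) \<partial>\<pi>)"
      using lip L by (intro nn_integral_mono) (simp flip: ennreal_mult)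
    finally have "(ennreal ?D)\<^sup>2 \<le> (\<integral>\<^sup>+z. ennreal L * ennreal (dist (fst z) (snd z)) \<partial>\<pi>)\<^sup>2"
      by (rule power_mono) simp
    also have "\<dots> \<le> (\<integral>\<^sup>+z. (ennreal L)\<^sup>2 \<partial>\<pi>) * (\<integral>\<^sup>+z. (ennreal (dist (fst z) (snd z)))\<^sup>2 \<partial>\<pi>)"
      by (rule Cauchy_Schwarz_nn_integral) measurable
    also have "\<dots> = ennreal (L\<^sup>2) * (\<integral>\<^sup>+z. ennreal ((dist (fst z) (snd z))\<^sup>2) \<partial>\<pi>)"
      using L by (simp add: emeasure_space_1 ennreal_power)
    finally have "ennreal (1 / L\<^sup>2) * ennreal (?D\<^sup>2) \<le> ennreal (1 / L\<^sup>2) *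
        (ennreal (L\<^sup>2) * (\<integral>\<^sup>+z. ennreal ((dist (fst z) (snd z))\<^sup>2) \<partial>\<pi>))"
      by (intro mult_left_mono) (auto simp: ennreal_power)
    then show ?thesis
      using L by (simp add: power_divide flip: ennreal_mult mult.assoc)
  qed
  then have "ennreal ((?D / L)\<^sup>2) \<le> ?I" by (rule INF_greatest)
  \<comment> \<open>Finiteness of the infimum is what lets \<open>enn2real\<close> preserve the
    inequality.\<close>
  moreover have "?I < \<infinity>"
    using INF_lower[OF pair_measure_in_couplings[OF P2]] couplings_cost_finite[OF P2 pair_measure_in_couplings[OF P2]]
    by (rule order_le_less_trans)
  ultimately have "(?D / L)\<^sup>2 \<le> enn2real ?I"
    by (metis enn2real_ennreal enn2real_mono infinity_ennreal_def zero_le_power2)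
  then have "sqrt ((?D / L)\<^sup>2) \<le> W2 \<mu> \<nu>"
    unfolding W2_def by (rule real_sqrt_le_mono)
  then have "?D / L \<le> W2 \<mu> \<nu>" using L by (subst (asm) real_sqrt_abs) simp
  then show ?thesis using L by (simp add: pos_divide_le_eq mult.commute)
qed

text \<open>Closedness makes the distance positive off \<open>A\<close>, so the ramps are eventually
  \<open>0\<close> there. Nonemptiness is required because \<open>infdist\<close> to the empty set
  is \<open>0\<close> by convention.\<close>

lemma indicator_closed_LIMSEQ:
  fixes A :: "'a::metric_space set"
  assumes "closed A" "A \<noteq> {}"
  shows "(\<lambda>n. max 0 (1 - real n * infdist x A)) \<longlonglongrightarrow> indicator A x"
proof (cases "x \<in> A")
  case False
  then have "infdist x A > 0"
    using assms in_closed_iff_infdist_zero[of A x] infdist_nonneg[of x A] by auto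
  then obtain N where N: "real N * infdist x A > 1"
    using reals_Archimedean3 by (metis mult.commute)
  have "max 0 (1 - real n * infdist x A) = 0" if "n \<ge> N" for n
    using N mult_right_mono[of "real N" "real n" "infdist x A"] that by (auto simp: infdist_nonneg)
  then have "eventually (\<lambda>n. max 0 (1 - real n * infdist x A) = 0) sequentially"
    by (auto simp: eventually_sequentially)
  with False show ?thesis by (simp add: tendsto_eventually)
qed simp

text \<open>The time is clamped to \<open>[0, T]\<close>, so that the kernel is defined for every real time. The
  continuity in \<open>W2\<close> gives the continuity of the integrals of Lipschitz functions, and these
  approximate the indicators of closed sets.\<close>

lemma P2_curve_kernel:
  assumes curve: "P2_curve T \<rho>" and "T > 0"
  shows "(\<lambda>t. \<rho> (max 0 (min T t))) \<in> borel \<rightarrow>\<^sub>M prob_algebra borel"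
proof (rule measurable_prob_algebra_generated[where \<Omega> = UNIV and G = "Collect closed"])
  define c where "c t = max 0 (min T t)" for t
  have c: "c t \<in> {0..T}" for t using \<open>T > 0\<close> by (auto simp: c_def)
  have P2: "\<rho> t \<in> P2" if "t \<in> {0..T}" for t using curve that by (auto simp: P2_curve_def)
  \<comment> \<open>Closed sets generate the Borel sets and are stable under intersection, so
    measurability of the kernel need only be checked on them.\<close>
  show "sets borel = sigma_sets UNIV (Collect closed :: 'a set set)"
    by (subst borel_eq_closed) simp
  show "Int_stable (Collect closed :: 'a set set)" by (auto simp: Int_stable_def)
  show "prob_space (\<rho> (max 0 (min T t)))" "sets (\<rho> (max 0 (min T t))) = sets borel" for t
    using P2D[OF P2[OF c[of t]]] by (simp_all add: c_def)
  fix A :: "'a set" assume "A \<in> Collect closed"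
  then have A: "closed A" by simp
  show "(\<lambda>t. emeasure (\<rho> (max 0 (min T t))) A) \<in> borel_measurable borel"
  proof (cases "A = {}")
    case False
    define f where "f n x = max 0 (1 - real n * infdist x A)" for n x
    have f_meas: "f n \<in> borel_measurable borel" for n
      unfolding f_def by (intro borel_measurable_continuous_onI continuous_intros)
    have f01: "\<bar>f n x\<bar> \<le> 1" for n x by (auto simp: f_def infdist_nonneg)
    \<comment> \<open>The constant is \<open>n + 1\<close> because the Wasserstein estimate asks for
      a positive Lipschitz constant and \<open>n\<close> may be \<open>0\<close>.\<close>
    have f_lip: "\<bar>f n x - f n y\<bar> \<le> (real n + 1) * dist x y" for n x y
    proof -
      have "\<bar>f n x - f n y\<bar> \<le> \<bar>real n * infdist x A - real n * infdist y A\<bar>"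
        by (auto simp: f_def)
      also have "\<dots> = real n * \<bar>infdist x A - infdist y A\<bar>"
        by (simp add: abs_mult flip: right_diff_distrib)
      also have "\<dots> \<le> (real n + 1) * dist x y"
        by (intro mult_mono infdist_triangle_abs) auto
      finally show ?thesis .
    qed
    have cont: "continuous_on {0..T} (\<lambda>t. LINT x|\<rho> t. f n x)" for n
      unfolding continuous_on_def
    proof
      fix t assume t: "t \<in> {0..T}"
      have lim: "((\<lambda>s. (real n + 1) * W2 (\<rho> s) (\<rho> t)) \<longlongrightarrow> 0) (at t within {0..T})"
        using curve t by (intro tendsto_mult_right_zero) (simp add: P2_curve_def)
      have "eventually (\<lambda>s. norm ((LINT x|\<rho> s. f n x) - (LINT x|\<rho> t. f n x))
          \<le> (real n + 1) * W2 (\<rho> s) (\<rho> t)) (at t within {0..T})"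
        unfolding eventually_at_filter real_norm_def
        by (intro always_eventually allI impI
            lipschitz_integral_diff_le_W2[OF P2 P2[OF t] f_lip _ f_meas f01]) simp_all
      then have "((\<lambda>s. (LINT x|\<rho> s. f n x) - (LINT x|\<rho> t. f n x)) \<longlongrightarrow> 0) (at t within {0..T})"
        by (rule Lim_null_comparison[OF _ lim])
      then show "((\<lambda>s. LINT x|\<rho> s. f n x) \<longlongrightarrow> (LINT x|\<rho> t. f n x)) (at t within {0..T})"
        by (rule LIM_zero_cancel)
    qed
    have "continuous_on UNIV c" unfolding c_def by (intro continuous_intros)
    then have "continuous_on UNIV (\<lambda>t. LINT x|\<rho> (c t). f n x)" for n
      by (rule continuous_on_compose2[OF cont]) (use c in auto)
    then have "(\<lambda>t. LINT x|\<rho> (c t). f n x) \<in> borel_measurable borel" for n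
      by (rule borel_measurable_continuous_onI)
    moreover have "(\<lambda>n. LINT x|\<rho> (c t). f n x) \<longlonglongrightarrow> measure (\<rho> (c t)) A" for t
    proof -
      interpret prob_space "\<rho> (c t)" by (rule P2D[OF P2[OF c]])
      note sets_\<rho>[measurable_cong] = P2D(1)[OF P2[OF c[of t]]]
      note f_meas[measurable]
      have [measurable]: "A \<in> sets borel" using A by (rule borel_closed)
      have "(\<lambda>n. LINT x|\<rho> (c t). f n x) \<longlonglongrightarrow> (LINT x|\<rho> (c t). indicator A x)"
      proof (rule integral_dominated_convergence[where w = "\<lambda>_. 1"])
        show "AE x in \<rho> (c t). (\<lambda>n. f n x) \<longlonglongrightarrow> indicator A x"
          using indicator_closed_LIMSEQ[OF A False] by (simp add: f_def)
      qed (use f01 in auto)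
      then show ?thesis using A by (simp add: sets_eq_imp_space_eq[OF sets_\<rho>])
    qed
    ultimately have "(\<lambda>t. measure (\<rho> (c t)) A) \<in> borel_measurable borel"
      by (rule borel_measurable_LIMSEQ_real[rotated])
    moreover have "emeasure (\<rho> (c t)) A = ennreal (measure (\<rho> (c t)) A)" for t
    proof -
      interpret prob_space "\<rho> (c t)" by (rule P2D[OF P2[OF c]])
      show ?thesis by (rule emeasure_eq_measure)
    qed
    ultimately show ?thesis by (simp add: c_def)
  qed simp
qed auto

section \<open>The second moment of the mollifier\<close>

lemma nn_integral_lborel_scaleR:
  fixes f :: "'a::euclidean_space \<Rightarrow> ennreal"
  assumes f: "f \<in> borel_measurable borel" and c: "c \<noteq> 0"
  shows "(\<integral>\<^sup>+x. f x \<partial>lborel) = ennreal (\<bar>c\<bar> ^ DIM('a)) * (\<integral>\<^sup>+x. f (c *\<^sub>R x) \<partial>lborel)"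
proof -
  note [measurable] = f
  show ?thesis
    by (subst lborel_affine[OF c, of 0])
      (simp add: nn_integral_density nn_integral_distr nn_integral_cmult)
qed

lemma nn_integral_lborel_translate:
  fixes f :: "'a::euclidean_space \<Rightarrow> ennreal"
  assumes f: "f \<in> borel_measurable borel"
  shows "(\<integral>\<^sup>+x. f (x - y) \<partial>lborel) = (\<integral>\<^sup>+x. f x \<partial>lborel)"
proof -
  note [measurable] = f
  have "(\<integral>\<^sup>+x. f (x - y) \<partial>lborel) = (\<integral>\<^sup>+x. f x \<partial>distr lborel borel ((+) (- y)))"
    by (simp add: nn_integral_distr)
  then show ?thesis by (simp add: lborel_distr_plus)
qed

text \<open>Halving the argument gains a linear term in the exponent, which later absorbs the factor
  \<open>(norm x)^2\<close>. For \<open>p = 1\<close> the two brackets are compared with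
  \<open>norm x\<close> separately; for \<open>p = 2\<close> a square is completed.\<close>

lemma bracket_power_diff_ge:
  assumes "p = 1 \<or> p = 2"
  shows "norm x / 2 - 1 \<le> bracket x ^ p - bracket (x /\<^sub>R 2) ^ p"
  using assms
proof
  assume p: "p = 1"
  have "norm x \<le> bracket x" unfolding bracket_def by (rule real_le_rsqrt) simp
  moreover have "bracket (x /\<^sub>R 2) \<le> 1 + norm x / 2"
    unfolding bracket_def by (rule real_le_lsqrt) (auto simp: power2_sum power_divide)
  ultimately show ?thesis using p by simp
next
  assume p: "p = 2"
  have "bracket x ^ 2 - bracket (x /\<^sub>R 2) ^ 2 - (norm x / 2 - 1) = (norm x)\<^sup>2 / 2 + (norm x / 2 - 1 / 2)\<^sup>2 + 3 / 4"
    by (simp add: bracket_def power2_diff power_divide field_simps)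
  also have "\<dots> \<ge> 0" by simp
  finally show ?thesis using p by simp
qed

text \<open>The \<open>8\<close> comes from the quadratic Taylor term of
  \<open>exp (norm x / 2)\<close>, the factor \<open>exp 1\<close> from the \<open>-1\<close> in the
  exponent gap. The majorant is a dilation of the profile itself, so no explicit integral is
  needed.\<close>

lemma second_moment_exp_bracket_le:
  assumes "p = 1 \<or> p = 2"
  shows "(norm x)\<^sup>2 * exp (- (bracket x ^ p)) \<le> 8 * exp 1 * exp (- (bracket (x /\<^sub>R 2) ^ p))"
proof -
  have "1 + norm x / 2 + (norm x)\<^sup>2 / 8 \<le> exp (norm x / 2)"
    using exp_lower_Taylor_quadratic[of "norm x / 2"] by (simp add: power_divide)
  then have "(norm x)\<^sup>2 \<le> 8 * exp (norm x / 2)"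
    using norm_ge_zero[of x] by linarith
  also have "\<dots> \<le> 8 * exp (1 + (bracket x ^ p - bracket (x /\<^sub>R 2) ^ p))"
    using bracket_power_diff_ge[OF assms, of x] by simp
  also have "\<dots> = 8 * exp 1 * exp (- (bracket (x /\<^sub>R 2) ^ p)) * exp (bracket x ^ p)"
    by (simp add: algebra_simps flip: exp_add)
  finally have "(norm x)\<^sup>2 * exp (- (bracket x ^ p))
      \<le> 8 * exp 1 * exp (- (bracket (x /\<^sub>R 2) ^ p)) * exp (bracket x ^ p) * exp (- (bracket x ^ p))"
    by (rule mult_right_mono) simp
  then show ?thesis by (simp add: mult.assoc flip: exp_add)
qed

text \<open>In the compactly supported case the weight is at most \<open>1\<close> on the support.
  In the other case the majorant \<open>e (z /\<^sub>R 2)\<close> has \<open>2 ^ DIM('a)\<close>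
  times the finite integral of \<open>e\<close>.\<close>

lemma V1_second_moment_finite:
  fixes V :: "'a::euclidean_space \<Rightarrow> real"
  assumes "V1_regular V" "V2_shape V"
  shows "(\<integral>\<^sup>+z. ennreal (V z * (norm z)\<^sup>2) \<partial>lborel) < \<infinity>"
proof -
  have V: "integrable lborel V" "\<And>x. V x \<ge> 0" "(LINT x|lborel. \<bar>V x\<bar>) = 1"
    using assms(1) by (auto simp: V1_regular_def)
  consider "closure {x. V x \<noteq> 0} \<subseteq> cball 0 1" | p where "p = 1 \<or> p = 2" "V = Np p"
    using assms(2) by (auto simp: V2_shape_def)
  then show ?thesis
  proof cases
    case 1
    have "V z * (norm z)\<^sup>2 \<le> V z" for z
    proof (cases "V z = 0")
      case False
      then have "z \<in> cball 0 1" using 1 closure_subset[of "{x. V x \<noteq> 0}"] by blast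
      then have "(norm z)\<^sup>2 \<le> 1" by (simp add: power_le_one)
      then show ?thesis using mult_left_mono[of "(norm z)\<^sup>2" 1 "V z"] V(2)[of z] by simp
    qed simp
    then have "(\<integral>\<^sup>+z. ennreal (V z * (norm z)\<^sup>2) \<partial>lborel) \<le> (\<integral>\<^sup>+z. ennreal (norm (V z)) \<partial>lborel)"
      using V(2) by (intro nn_integral_mono ennreal_leI) simp
    also have "\<dots> < \<infinity>" using integrableD(2)[OF V(1)] V(2) by (simp add: less_top abs_of_nonneg)
    finally show ?thesis .
  next
    case (2 p)
    define e where "e x = exp (- (bracket x ^ p))" for x :: 'a
    define Z where "Z = (LINT y|lborel. e y)"
    have Ve: "V x = e x / Z" for x using 2 by (simp add: Np_def e_def Z_def)
    \<comment> \<open>With \<open>Z = 0\<close>, division by zero would make \<open>V\<close>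
      vanish, against its unit mass. Since a nonexistent Bochner integral is \<open>0\<close>, this
      also yields the integrability of \<open>e\<close>.\<close>
    have "Z \<noteq> 0" using V(3) by (auto simp: Ve)
    then have e: "integrable lborel e" unfolding Z_def by (metis not_integrable_integral_eq)
    have "Z \<ge> 0" unfolding Z_def by (intro integral_nonneg_AE) (simp add: e_def)
    with \<open>Z \<noteq> 0\<close> have Z: "Z > 0" by simp
    have [measurable]: "e \<in> borel_measurable borel"
      unfolding e_def bracket_def by (intro borel_measurable_continuous_onI continuous_intros)
    have e_fin: "(\<integral>\<^sup>+z. ennreal (e z) \<partial>lborel) < \<infinity>"
      using integrableD(2)[OF e] by (simp add: e_def less_top)
    have "V z * (norm z)\<^sup>2 \<le> 8 * exp 1 / Z * e (z /\<^sub>R 2)" for z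
      using divide_right_mono[OF second_moment_exp_bracket_le[OF 2(1), of z], of Z] Z
      by (simp add: Ve e_def mult.commute)
    then have "(\<integral>\<^sup>+z. ennreal (V z * (norm z)\<^sup>2) \<partial>lborel)
        \<le> (\<integral>\<^sup>+z. ennreal (8 * exp 1 / Z) * ennreal (e (z /\<^sub>R 2)) \<partial>lborel)"
      using Z by (intro nn_integral_mono) (auto simp: e_def simp flip: ennreal_mult intro!: ennreal_leI)
    also have "\<dots> = ennreal (8 * exp 1 / Z) * (\<integral>\<^sup>+z. ennreal (e (z /\<^sub>R 2)) \<partial>lborel)"
      by (rule nn_integral_cmult) measurable
    also have "(\<integral>\<^sup>+z. ennreal (e (z /\<^sub>R 2)) \<partial>lborel) = ennreal (\<bar>2\<bar> ^ DIM('a)) * (\<integral>\<^sup>+z. ennreal (e z) \<partial>lborel)"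
      by (subst nn_integral_lborel_scaleR[of _ 2]) auto
    also have "ennreal (8 * exp 1 / Z) * (ennreal (\<bar>2\<bar> ^ DIM('a)) * (\<integral>\<^sup>+z. ennreal (e z) \<partial>lborel)) < \<infinity>"
      using e_fin by (simp add: ennreal_mult_less_top)
    finally show ?thesis .
  qed
qed

text \<open>The Jacobian of the dilation cancels the normalisation of \<open>rescale\<close>; the
  squared norm leaves \<open>\<epsilon>^2\<close>, the source of the factor
  \<open>\<epsilon>\<close> in the final bound.\<close>

lemma nn_integral_rescale_second_moment:
  fixes V :: "'a::euclidean_space \<Rightarrow> real"
  assumes V: "V \<in> borel_measurable borel" "\<And>x. V x \<ge> 0" and "\<epsilon> > 0"
  shows "(\<integral>\<^sup>+z. ennreal (rescale \<epsilon> V z * (norm z)\<^sup>2) \<partial>lborel)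
    = ennreal (\<epsilon>\<^sup>2) * (\<integral>\<^sup>+z. ennreal (V z * (norm z)\<^sup>2) \<partial>lborel)"
proof -
  note [measurable] = V(1)
  have "(\<integral>\<^sup>+z. ennreal (rescale \<epsilon> V z * (norm z)\<^sup>2) \<partial>lborel) = ennreal (\<epsilon> ^ DIM('a)) *
      (\<integral>\<^sup>+z. ennreal (rescale \<epsilon> V (\<epsilon> *\<^sub>R z) * (norm (\<epsilon> *\<^sub>R z))\<^sup>2) \<partial>lborel)"
    using \<open>\<epsilon> > 0\<close> unfolding rescale_def by (subst nn_integral_lborel_scaleR[of _ \<epsilon>]) auto
  also have "\<dots> = (\<integral>\<^sup>+z. ennreal (\<epsilon> ^ DIM('a)) * ennreal (rescale \<epsilon> V (\<epsilon> *\<^sub>R z) * (norm (\<epsilon> *\<^sub>R z))\<^sup>2) \<partial>lborel)"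
    unfolding rescale_def by (rule nn_integral_cmult[symmetric]) measurable
  also have "\<dots> = (\<integral>\<^sup>+z. ennreal (\<epsilon>\<^sup>2) * ennreal (V z * (norm z)\<^sup>2) \<partial>lborel)"
    using \<open>\<epsilon> > 0\<close> V(2)
    by (intro nn_integral_cong) (simp add: rescale_def power_mult_distrib field_simps flip: ennreal_mult)
  also have "\<dots> = ennreal (\<epsilon>\<^sup>2) * (\<integral>\<^sup>+z. ennreal (V z * (norm z)\<^sup>2) \<partial>lborel)"
    by (rule nn_integral_cmult) measurable
  finally show ?thesis .
qed

section \<open>The commutator estimate\<close>

text \<open>Writing \<open>k\<close> as \<open>sqrt k * sqrt k\<close> makes the first
  Cauchy-Schwarz factor exactly the mass under the root in the denominator. The bounds
  \<open>K\<close> and \<open>B\<close> secure the Bochner integrability of the two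
  convolutions.\<close>

lemma commutator_pointwise_le:
  fixes k :: "'a::euclidean_space \<Rightarrow> real" and g :: "'a \<Rightarrow> 'a"
  assumes "prob_space M" and sets_M: "sets M = sets borel"
    and k: "k \<in> borel_measurable borel" "\<And>x. 0 \<le> k x" "\<And>x. k x \<le> K"
    and g: "g \<in> borel_measurable borel" "\<And>x. norm (g x) \<le> B"
    and lip: "\<And>x y. norm (g y - g x) \<le> L * norm (y - x)" and "L \<ge> 0"
    and pos: "conv k (\<lambda>_. 1::real) M x > 0"
  shows "ennreal ((norm ((conv k g M x - conv k (\<lambda>_. 1) M x *\<^sub>R g x) /\<^sub>R sqrt (conv k (\<lambda>_. 1) M x)))\<^sup>2)
    \<le> ennreal (L\<^sup>2) * (\<integral>\<^sup>+y. ennreal (k (x - y) * (norm (x - y))\<^sup>2) \<partial>M)"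
proof -
  interpret prob_space M by fact
  note [measurable_cong] = sets_M and [measurable] = k(1) g(1)
  define c where "c = conv k (\<lambda>_. 1::real) M x"
  let ?N = "norm (conv k g M x - c *\<^sub>R g x)"
  have k_int: "integrable M (\<lambda>y. k (x - y))"
    by (rule integrable_const_bound[of _ K]) (auto simp: k abs_of_nonneg)
  have c: "c = (LINT y|M. k (x - y))" by (simp add: c_def conv_def)
  have kg_int: "integrable M (\<lambda>y. k (x - y) *\<^sub>R g y)"
  proof (rule integrable_const_bound[of _ "K * B"])
    show "AE y in M. norm (k (x - y) *\<^sub>R g y) \<le> K * B"
      by (intro AE_I2) (auto simp: k g abs_of_nonneg intro!: mult_mono order_trans[OF k(2,3)])
  qed measurable
  \<comment> \<open>As \<open>g x\<close> is constant in \<open>y\<close> and \<open>c\<close> is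
    the integral of \<open>k (x - y)\<close>, the numerator is a single integral of increments of
    \<open>g\<close>.\<close>
  have "conv k g M x - c *\<^sub>R g x = (LINT y|M. k (x - y) *\<^sub>R (g y - g x))"
    using k_int kg_int by (simp add: c conv_def scaleR_diff_right)
  then have "ennreal ?N = ennreal (norm (LINT y|M. k (x - y) *\<^sub>R (g y - g x)))"
    by simp
  also have "\<dots> \<le> (\<integral>\<^sup>+y. norm (k (x - y) *\<^sub>R (g y - g x)) \<partial>M)"
    using k_int kg_int by (intro integral_norm_bound_ennreal) (simp add: scaleR_diff_right)
  also have "\<dots> \<le> (\<integral>\<^sup>+y. ennreal (sqrt (k (x - y))) * ennreal (sqrt (k (x - y)) * (L * norm (x - y))) \<partial>M)"
  proof (intro nn_integral_mono)
    fix y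
    have "norm (k (x - y) *\<^sub>R (g y - g x)) \<le> k (x - y) * (L * norm (x - y))"
      using mult_left_mono[OF lip[of y x] k(2)] by (simp add: k norm_minus_commute)
    also have "\<dots> = sqrt (k (x - y)) * (sqrt (k (x - y)) * (L * norm (x - y)))"
      by (simp add: k flip: mult.assoc)
    finally show "ennreal (norm (k (x - y) *\<^sub>R (g y - g x)))
        \<le> ennreal (sqrt (k (x - y))) * ennreal (sqrt (k (x - y)) * (L * norm (x - y)))"
      using \<open>L \<ge> 0\<close> by (simp add: k ennreal_leI flip: ennreal_mult)
  qed
  finally have "(ennreal ?N)\<^sup>2
      \<le> (\<integral>\<^sup>+y. ennreal (sqrt (k (x - y))) * ennreal (sqrt (k (x - y)) * (L * norm (x - y))) \<partial>M)\<^sup>2"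
    by (rule power_mono) simp
  also have "\<dots> \<le> (\<integral>\<^sup>+y. (ennreal (sqrt (k (x - y))))\<^sup>2 \<partial>M)
      * (\<integral>\<^sup>+y. (ennreal (sqrt (k (x - y)) * (L * norm (x - y))))\<^sup>2 \<partial>M)"
    by (rule Cauchy_Schwarz_nn_integral) measurable
  also have "(\<integral>\<^sup>+y. (ennreal (sqrt (k (x - y))))\<^sup>2 \<partial>M) = ennreal c"
    using k_int by (simp add: ennreal_power k c nn_integral_eq_integral)
  also have "(\<integral>\<^sup>+y. (ennreal (sqrt (k (x - y)) * (L * norm (x - y))))\<^sup>2 \<partial>M)
      = (\<integral>\<^sup>+y. ennreal (L\<^sup>2) * ennreal (k (x - y) * (norm (x - y))\<^sup>2) \<partial>M)"
    using \<open>L \<ge> 0\<close> by (intro nn_integral_cong)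
      (simp add: ennreal_power k power_mult_distrib mult.left_commute flip: ennreal_mult)
  also have "\<dots> = ennreal (L\<^sup>2) * (\<integral>\<^sup>+y. ennreal (k (x - y) * (norm (x - y))\<^sup>2) \<partial>M)" (is "_ = ?R")
    by (rule nn_integral_cmult) measurable
  \<comment> \<open>Division by \<open>c\<close> is done as multiplication by
    \<open>ennreal (1 / c)\<close>, which cancels once \<open>c > 0\<close> is known.\<close>
  finally have "ennreal (1 / c) * ennreal (?N\<^sup>2) \<le> ennreal (1 / c) * (ennreal c * ?R)"
    by (intro mult_left_mono) (auto simp: ennreal_power)
  moreover have "c > 0" using pos by (simp add: c_def)
  ultimately have "ennreal (?N\<^sup>2 / c) \<le> ?R"
    by (simp flip: ennreal_mult mult.assoc)
  moreover have "(norm ((conv k g M x - c *\<^sub>R g x) /\<^sub>R sqrt c))\<^sup>2 = ?N\<^sup>2 / c"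
    using \<open>c > 0\<close> by (simp add: power_mult_distrib power_inverse divide_inverse mult.commute)
  ultimately show ?thesis by (simp add: c_def)
qed

text \<open>Tonelli, translation invariance of Lebesgue measure and the unit mass of
  \<open>M\<close>.\<close>

lemma nn_integral_convolution:
  fixes f :: "'a::euclidean_space \<Rightarrow> ennreal"
  assumes "prob_space M" and sets_M: "sets M = sets borel" and f: "f \<in> borel_measurable borel"
  shows "(\<integral>\<^sup>+x. (\<integral>\<^sup>+y. f (x - y) \<partial>M) \<partial>lborel) = (\<integral>\<^sup>+z. f z \<partial>lborel)"
proof -
  note [measurable_cong] = sets_M and [measurable] = f
  interpret M: prob_space M by fact
  interpret pair_sigma_finite M lborel ..
  have "(\<integral>\<^sup>+x. (\<integral>\<^sup>+y. f (x - y) \<partial>M) \<partial>lborel) = (\<integral>\<^sup>+y. (\<integral>\<^sup>+x. f (x - y) \<partial>lborel) \<partial>M)"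
    by (rule Fubini'[of "\<lambda>y x. f (x - y)"]) measurable
  then show ?thesis by (simp add: nn_integral_lborel_translate[OF f] M.emeasure_space_1)
qed

text \<open>By continuity the essential supremum bounds the Hessian at every point. As a function of
  time it is bounded on an interval of finite length, hence square integrable once
  measurable.\<close>

lemma Linf_norm_hess_slice:
  fixes \<phi> :: "real \<times> 'a::euclidean_space \<Rightarrow> real"
  assumes "C2_compact T \<phi>"
  defines "H \<equiv> \<lambda>t. Linf_norm lborel (hess (\<lambda>x. \<phi> (t, x)))"
  shows norm_hess_slice_le: "\<And>t x. t \<in> {0..T} \<Longrightarrow> norm (hess (\<lambda>x. \<phi> (t, x)) x) \<le> H t"
    and integrable_Linf_hess_slice_square: "integrable (restrict_space lborel {0..T}) (\<lambda>t. (H t)\<^sup>2)"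
proof -
  define h where "h = (\<lambda>(t, x). hess (\<lambda>y. \<phi> (t, y)) x)"
  have h: "continuous_on ({0..T} \<times> UNIV) h"
    unfolding h_def using assms(1) by (intro continuous_on_hess_slice) (simp add: C2_compact_def)
  obtain B where B: "\<And>z. z \<in> {0..T} \<times> UNIV \<Longrightarrow> norm (h z) \<le> B"
    using bounded_hess_slice[OF assms(1)] unfolding h_def[symmetric] bounded_iff by blast
  \<comment> \<open>This equivalence gives the pointwise bound, writes the sublevel sets of
    \<open>H\<close> as intersections over \<open>x\<close>, and gives
    \<open>H t <= B\<close>.\<close>
  have le_iff: "H t \<le> a \<longleftrightarrow> (\<forall>x. norm (h (t, x)) \<le> a)" if t: "t \<in> {0..T}" for t a
  proof -
    have "continuous_on UNIV (\<lambda>x. h (t, x))"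
      by (rule continuous_on_compose2[OF h]) (use t in \<open>auto intro!: continuous_intros\<close>)
    moreover have "bounded (range (\<lambda>x. h (t, x)))"
      unfolding bounded_iff using B t by (intro exI[of _ B]) auto
    ultimately have "Linf_norm lborel (\<lambda>x. h (t, x)) \<le> a \<longleftrightarrow> (\<forall>x. norm (h (t, x)) \<le> a)"
      by (rule Linf_norm_le_iff)
    then show ?thesis by (simp add: h_def H_def)
  qed
  show *: "norm (hess (\<lambda>x. \<phi> (t, x)) x) \<le> H t" if "t \<in> {0..T}" for t x
    using le_iff[OF that, of "H t"] by (simp add: h_def)
  \<comment> \<open>A Bochner integral that does not exist is \<open>0\<close>, so the measurability of \<open>H\<close> matters: as a
    supremum of continuous functions it is lower semicontinuous.\<close>
  have "{t \<in> {0..T}. H t \<le> a} \<in> sets borel" for a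
  proof -
    have "closed {t \<in> {0..T}. norm (h (t, x)) \<le> a}" for x
    proof (rule continuous_on_closed_Collect_le)
      show "continuous_on {0..T} (\<lambda>t. norm (h (t, x)))"
        by (intro continuous_on_norm continuous_on_compose2[OF h]) (auto intro!: continuous_intros)
    qed auto
    then have "closed (\<Inter>x. {t \<in> {0..T}. norm (h (t, x)) \<le> a})"
      by blast
    moreover have "{t \<in> {0..T}. H t \<le> a} = (\<Inter>x. {t \<in> {0..T}. norm (h (t, x)) \<le> a})"
      using le_iff by auto
    ultimately show ?thesis by simp
  qed
  then have [measurable]: "H \<in> borel_measurable (restrict_space lborel {0..T})"
    by (auto simp: borel_measurable_iff_le sets_restrict_space_iff space_restrict_space)
  interpret finite_measure "restrict_space lborel {0..T}"
    by (rule finite_measureI)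
      (simp add: emeasure_restrict_space space_restrict_space emeasure_lborel_Icc_eq)
  show "integrable (restrict_space lborel {0..T}) (\<lambda>t. (H t)\<^sup>2)"
  proof (rule integrable_const_bound[of _ "B\<^sup>2"])
    show "AE t in restrict_space lborel {0..T}. norm ((H t)\<^sup>2) \<le> B\<^sup>2"
    proof (rule AE_I2)
      fix t assume "t \<in> space (restrict_space lborel {0..T})"
      then have t: "t \<in> {0..T}" by (simp add: space_restrict_space)
      have "0 \<le> H t" using *[OF t, of 0] norm_ge_zero order_trans by blast
      moreover have "H t \<le> B" using le_iff[OF t] B t by simp
      ultimately show "norm ((H t)\<^sup>2) \<le> B\<^sup>2" by (simp add: power_mono)
    qed
  qed measurable
qed

text \<open>Mean value inequality on the convex whole space; it relies on the Hessian bound holding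
  everywhere, not just almost everywhere.\<close>

lemma grad_slice_lipschitz:
  fixes \<phi> :: "real \<times> 'a::euclidean_space \<Rightarrow> real"
  assumes "C2_compact T \<phi>" "t \<in> {0..T}"
  shows "norm (grad (\<lambda>x. \<phi> (t, x)) y - grad (\<lambda>x. \<phi> (t, x)) x)
    \<le> Linf_norm lborel (hess (\<lambda>x. \<phi> (t, x))) * norm (y - x)"
proof (rule differentiable_bound[OF convex_UNIV])
  show "(grad (\<lambda>x. \<phi> (t, x)) has_derivative hess (\<lambda>x. \<phi> (t, x)) z) (at z)" for z
    using assms by (intro has_derivative_grad_slice) (auto simp: C2_compact_def)
  show "onorm (blinfun_apply (hess (\<lambda>x. \<phi> (t, x)) z)) \<le> Linf_norm lborel (hess (\<lambda>x. \<phi> (t, x)))" for z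
    using norm_hess_slice_le[OF assms] by (simp add: norm_blinfun.rep_eq)
qed auto

text \<open>Joint measurability in time and space is needed for Tonelli and for
  \<open>in_L2\<close>. With time clamped, both convolutions are parametric integrals against the
  kernel of the curve.\<close>

lemma commutator_measurable:
  fixes \<phi> :: "real \<times> 'a::euclidean_space \<Rightarrow> real"
  assumes "T > 0" and curve: "P2_curve T \<rho>" and \<phi>: "C2_compact T \<phi>" and k: "k \<in> borel_measurable borel"
  shows "(\<lambda>(t, x). commutator k \<rho> \<phi> (max 0 (min T t), x)) \<in> borel_measurable borel"
proof -
  note [measurable] = k
  define c where "c t = max 0 (min T t)" for t
  have c: "c t \<in> {0..T}" for t using \<open>T > 0\<close> by (auto simp: c_def)
  have c_cont: "continuous_on UNIV c" unfolding c_def by (intro continuous_intros)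
  define G where "G p = grad (\<lambda>y. \<phi> (c (fst p), y)) (snd p)" for p
  have "continuous_on ({0..T} \<times> UNIV) (\<lambda>(t, x). grad (\<lambda>y. \<phi> (t, y)) x)"
    using \<phi> by (intro continuous_on_grad_slice) (simp add: C2_compact_def)
  then have "continuous_on UNIV (\<lambda>p. (\<lambda>(t, x). grad (\<lambda>y. \<phi> (t, y)) x) (c (fst p), snd p))"
    by (rule continuous_on_compose2)
      (use c in \<open>auto intro!: continuous_intros continuous_on_compose2[OF c_cont]\<close>)
  then have "G \<in> borel_measurable borel"
    unfolding G_def by (intro borel_measurable_continuous_onI) simp
  then have G[measurable]: "G \<in> borel_measurable (borel \<Otimes>\<^sub>M borel)"
    unfolding borel_prod .
  have \<rho>: "(\<lambda>p. \<rho> (c (fst p))) \<in> (borel :: real measure) \<Otimes>\<^sub>M (borel :: 'a measure) \<rightarrow>\<^sub>M subprob_algebra borel"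
    using measurable_compose[OF measurable_fst measurable_prob_algebraD[OF P2_curve_kernel[OF curve \<open>T > 0\<close>]]]
    by (simp add: c_def)
  \<comment> \<open>The pair \<open>p\<close> of time and space is the parameter: it enters the
    measure through \<open>fst p\<close> and the integrand through \<open>snd p\<close>.\<close>
  have m1: "(\<lambda>p. conv k (\<lambda>_. 1::real) (\<rho> (c (fst p))) (snd p)) \<in> borel_measurable (borel \<Otimes>\<^sub>M borel)"
    unfolding conv_def by (rule integral_measurable_subprob_algebra2[OF _ \<rho>]) measurable
  have m2: "(\<lambda>p. conv k (\<lambda>y. G (fst p, y)) (\<rho> (c (fst p))) (snd p)) \<in> borel_measurable (borel \<Otimes>\<^sub>M borel)"
    unfolding conv_def by (rule integral_measurable_subprob_algebra2[OF _ \<rho>]) measurable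
  note [measurable] = m1 m2
  have "(\<lambda>p. if conv k (\<lambda>_. 1::real) (\<rho> (c (fst p))) (snd p) > 0
      then (conv k (\<lambda>y. G (fst p, y)) (\<rho> (c (fst p))) (snd p)
          - conv k (\<lambda>_. 1::real) (\<rho> (c (fst p))) (snd p) *\<^sub>R G p)
        /\<^sub>R sqrt (conv k (\<lambda>_. 1::real) (\<rho> (c (fst p))) (snd p))
      else 0) \<in> borel_measurable (borel \<Otimes>\<^sub>M borel)"
    by measurable
  then show ?thesis
    unfolding borel_prod
    by (rule measurable_cong[THEN iffD1, rotated]) (simp add: commutator_def Let_def G_def c_def split_beta)
qed

section \<open>Integration of the pointwise estimate in space and time\<close>

theorem lemma4p2:
  fixes V1 :: "'a::euclidean_space \<Rightarrow> real"
  assumes "V1_regular V1" and "V2_shape V1"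
  shows "\<exists>C::real. \<forall>T>0. \<forall>\<rho>. P2_curve T \<rho> \<longrightarrow>
    (\<forall>\<epsilon>>0. \<forall>\<phi>. C2_compact T \<phi> \<longrightarrow>
      in_L2 (restrict_space lborel ({0..T} \<times> UNIV)) (commutator (rescale \<epsilon> V1) \<rho> \<phi>) \<and>
      L2_norm (restrict_space lborel ({0..T} \<times> UNIV)) (commutator (rescale \<epsilon> V1) \<rho> \<phi>)
        \<le> \<epsilon> * C * L2_norm (restrict_space lborel {0..T})
                    (\<lambda>t. Linf_norm lborel (hess (\<lambda>x. \<phi> (t, x)))))"
proof -
  define m where "m = enn2real (\<integral>\<^sup>+z. ennreal (V1 z * (norm z)\<^sup>2) \<partial>lborel)"
  have m: "(\<integral>\<^sup>+z. ennreal (V1 z * (norm z)\<^sup>2) \<partial>lborel) = ennreal m"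
    using V1_second_moment_finite[OF assms] by (simp add: m_def)
  have "m \<ge> 0" by (simp add: m_def)
  have V1: "continuous_on UNIV V1" "\<And>x. 0 \<le> V1 x" "bounded (range V1)"
    using assms(1) by (auto simp: V1_regular_def)
  then obtain K where K: "\<And>x. V1 x \<le> K" unfolding bounded_iff by (auto simp: abs_le_iff)
  have V1_meas[measurable]: "V1 \<in> borel_measurable borel"
    using V1(1) by (rule borel_measurable_continuous_onI)
  show ?thesis
  \<comment> \<open>The witness depends on \<open>V1\<close> alone and is fixed before
    \<open>T\<close>, \<open>\<rho>\<close>, \<open>\<epsilon>\<close> and
    \<open>\<phi>\<close>.\<close>
  proof (rule exI[of _ "sqrt m"], intro allI impI)
    fix T :: real and \<rho> :: "real \<Rightarrow> 'a measure" and \<epsilon> :: real and \<phi> :: "real \<times> 'a \<Rightarrow> real"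
    assume T: "T > 0" and curve: "P2_curve T \<rho>" and \<epsilon>: "\<epsilon> > 0" and \<phi>: "C2_compact T \<phi>"
    define k where "k = rescale \<epsilon> V1"
    have k[measurable]: "k \<in> borel_measurable borel" unfolding k_def rescale_def by measurable
    have k0: "0 \<le> k x" and kK: "k x \<le> K / \<epsilon> ^ DIM('a)" for x
      using V1(2) K \<epsilon> by (simp_all add: k_def rescale_def divide_right_mono)
    define H where "H t = Linf_norm lborel (hess (\<lambda>x. \<phi> (t, x)))" for t
    have H0: "0 \<le> H t" if "t \<in> {0..T}" for t
      using norm_hess_slice_le[OF \<phi> that, of 0] unfolding H_def by (rule order_trans[OF norm_ge_zero])
    have H2: "integrable (restrict_space lborel {0..T}) (\<lambda>t. (H t)\<^sup>2)"
      using integrable_Linf_hess_slice_square[OF \<phi>] by (simp add: H_def)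
    let ?S = "{0..T} \<times> (UNIV :: 'a set)"
    let ?C = "commutator k \<rho> \<phi>"
    \<comment> \<open>Clamping time gives a Borel function on all of space-time that agrees with the
      commutator on the strip; Tonelli is applied to it.\<close>
    define E where "E = (\<lambda>(t, x). ?C (max 0 (min T t), x))"
    have E[measurable]: "E \<in> borel_measurable borel"
      unfolding E_def by (rule commutator_measurable[OF T curve \<phi> k])
    have E_eq: "E z = ?C z" if "z \<in> ?S" for z using that by (auto simp: E_def)
    have S: "?S \<in> sets borel" by (intro borel_closed closed_Times) auto
    have sp: "space (restrict_space lborel ?S) = ?S" by (simp add: space_restrict_space)
    have C_meas: "?C \<in> borel_measurable (restrict_space lborel ?S)"
    proof -
      have "E \<in> borel_measurable (restrict_space lborel ?S)"
        by (rule measurable_restrict_space1) simp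
      then show ?thesis by (rule measurable_cong[THEN iffD1, rotated]) (simp add: sp E_eq)
    qed
    have slice: "(\<integral>\<^sup>+x. ennreal ((norm (?C (t, x)))\<^sup>2) \<partial>lborel) \<le> ennreal ((H t)\<^sup>2) * ennreal (\<epsilon>\<^sup>2 * m)"
      if t: "t \<in> {0..T}" for t
    proof -
      have "\<rho> t \<in> P2" using curve t by (simp add: P2_curve_def)
      note \<rho>t = P2D[OF this]
      note [measurable_cong] = \<rho>t(1)
      define g where "g = grad (\<lambda>x. \<phi> (t, x))"
      have lip: "norm (g y - g x) \<le> H t * norm (y - x)" for x y
        using grad_slice_lipschitz[OF \<phi> t] by (simp add: g_def H_def)
      have "range g \<subseteq> (\<lambda>(t, x). grad (\<lambda>y. \<phi> (t, y)) x) ` ?S"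
        using t by (force simp: g_def)
      then obtain B where B: "\<And>x. norm (g x) \<le> B"
        using bounded_subset[OF bounded_grad_slice[OF \<phi>]] unfolding bounded_iff by blast
      have g_meas: "g \<in> borel_measurable borel"
      proof (intro borel_measurable_continuous_onI)
        have "(H t)-lipschitz_on UNIV g"
          using lip H0[OF t] by (intro lipschitz_onI) (auto simp: dist_norm norm_minus_commute)
        then show "continuous_on UNIV g" by (rule lipschitz_on_continuous_on)
      qed
      \<comment> \<open>Where the mollified density is not positive, the commutator is
        \<open>0\<close> and the bound is trivial.\<close>
      have "ennreal ((norm (?C (t, x)))\<^sup>2)
          \<le> ennreal ((H t)\<^sup>2) * (\<integral>\<^sup>+y. ennreal (k (x - y) * (norm (x - y))\<^sup>2) \<partial>\<rho> t)" for x
        using commutator_pointwise_le[OF \<rho>t(2,1) k k0 kK g_meas B lip H0[OF t], of x]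
        by (simp add: commutator_def Let_def g_def)
      then have "(\<integral>\<^sup>+x. ennreal ((norm (?C (t, x)))\<^sup>2) \<partial>lborel)
          \<le> (\<integral>\<^sup>+x. ennreal ((H t)\<^sup>2) * (\<integral>\<^sup>+y. ennreal (k (x - y) * (norm (x - y))\<^sup>2) \<partial>\<rho> t) \<partial>lborel)"
        by (intro nn_integral_mono)
      also have "\<dots> = ennreal ((H t)\<^sup>2)
          * (\<integral>\<^sup>+x. (\<integral>\<^sup>+y. ennreal (k (x - y) * (norm (x - y))\<^sup>2) \<partial>\<rho> t) \<partial>lborel)"
      proof (rule nn_integral_cmult)
        interpret prob_space "\<rho> t" by (rule \<rho>t(2))
        show "(\<lambda>x. \<integral>\<^sup>+y. ennreal (k (x - y) * (norm (x - y))\<^sup>2) \<partial>\<rho> t) \<in> borel_measurable lborel"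
          by measurable
      qed
      also have "\<dots> = ennreal ((H t)\<^sup>2) * ennreal (\<epsilon>\<^sup>2 * m)"
        using nn_integral_convolution[OF \<rho>t(2,1), of "\<lambda>z. ennreal (k z * (norm z)\<^sup>2)"]
          nn_integral_rescale_second_moment[OF V1_meas V1(2) \<epsilon>] \<open>m \<ge> 0\<close>
        by (simp add: k_def[symmetric] m ennreal_mult)
      finally show ?thesis .
    qed
    have "(\<integral>\<^sup>+z. ennreal ((norm (?C z))\<^sup>2) \<partial>restrict_space lborel ?S)
        = (\<integral>\<^sup>+z. ennreal ((norm (?C z))\<^sup>2) * indicator ?S z \<partial>lborel)"
      using S by (intro nn_integral_restrict_space) simp
    also have "\<dots> = (\<integral>\<^sup>+z. ennreal ((norm (E z))\<^sup>2) * indicator ?S z \<partial>(lborel \<Otimes>\<^sub>M lborel))"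
      unfolding lborel_prod by (intro nn_integral_cong) (auto simp: E_eq indicator_def)
    also have "\<dots> = (\<integral>\<^sup>+t. (\<integral>\<^sup>+x. ennreal ((norm (E (t, x)))\<^sup>2) * indicator ?S (t, x) \<partial>lborel) \<partial>lborel)"
    proof (rule lborel.nn_integral_fst[symmetric])
      show "(\<lambda>z. ennreal ((norm (E z))\<^sup>2) * indicator ?S z) \<in> borel_measurable (lborel \<Otimes>\<^sub>M lborel)"
        unfolding lborel_prod using S by measurable
    qed
    also have "\<dots> \<le> (\<integral>\<^sup>+t. ennreal ((H t)\<^sup>2) * ennreal (\<epsilon>\<^sup>2 * m) * indicator {0..T} t \<partial>lborel)"
    proof (intro nn_integral_mono)
      fix t
      show "(\<integral>\<^sup>+x. ennreal ((norm (E (t, x)))\<^sup>2) * indicator ?S (t, x) \<partial>lborel)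
          \<le> ennreal ((H t)\<^sup>2) * ennreal (\<epsilon>\<^sup>2 * m) * indicator {0..T} t"
        using slice[of t] by (cases "t \<in> {0..T}") (auto simp: E_eq)
    qed
    also have "\<dots> = (\<integral>\<^sup>+t. ennreal ((H t)\<^sup>2) * ennreal (\<epsilon>\<^sup>2 * m) \<partial>restrict_space lborel {0..T})"
      by (rule nn_integral_restrict_space[symmetric]) simp
    also have "\<dots> = (\<integral>\<^sup>+t. ennreal ((H t)\<^sup>2) \<partial>restrict_space lborel {0..T}) * ennreal (\<epsilon>\<^sup>2 * m)"
      using H2 by (intro nn_integral_multc) auto
    also have "\<dots> = ennreal ((LINT t|restrict_space lborel {0..T}. (H t)\<^sup>2) * (\<epsilon>\<^sup>2 * m))"
      using H2 \<open>m \<ge> 0\<close> by (simp add: nn_integral_eq_integral ennreal_mult)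
    finally have bound: "(\<integral>\<^sup>+z. ennreal ((norm (?C z))\<^sup>2) \<partial>restrict_space lborel ?S)
        \<le> ennreal ((LINT t|restrict_space lborel {0..T}. (H t)\<^sup>2) * (\<epsilon>\<^sup>2 * m))" .
    \<comment> \<open>Integrability is settled before real integrals are compared: it is part of
      \<open>in_L2\<close>, and it identifies the Bochner integral with the bounded nonnegative
      one.\<close>
    have int: "integrable (restrict_space lborel ?S) (\<lambda>z. (norm (?C z))\<^sup>2)"
    proof (rule integrableI_bounded)
      show "(\<lambda>z. (norm (?C z))\<^sup>2) \<in> borel_measurable (restrict_space lborel ?S)"
        using C_meas by measurable
      show "(\<integral>\<^sup>+z. ennreal (norm ((norm (?C z))\<^sup>2)) \<partial>restrict_space lborel ?S) < \<infinity>"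
        using bound by (simp add: order_le_less_trans)
    qed
    have "ennreal (LINT z|restrict_space lborel ?S. (norm (?C z))\<^sup>2)
        \<le> ennreal ((LINT t|restrict_space lborel {0..T}. (H t)\<^sup>2) * (\<epsilon>\<^sup>2 * m))"
      using bound by (simp add: nn_integral_eq_integral[OF int])
    then have "(LINT z|restrict_space lborel ?S. (norm (?C z))\<^sup>2)
        \<le> (LINT t|restrict_space lborel {0..T}. (H t)\<^sup>2) * (\<epsilon>\<^sup>2 * m)"
      using \<open>m \<ge> 0\<close> by (simp add: ennreal_le_iff)
    then have "L2_norm (restrict_space lborel ?S) ?C
        \<le> sqrt ((LINT t|restrict_space lborel {0..T}. (H t)\<^sup>2) * (\<epsilon>\<^sup>2 * m))"
      unfolding L2_norm_def by (rule real_sqrt_le_mono)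
    also have "\<dots> = \<epsilon> * sqrt m * L2_norm (restrict_space lborel {0..T}) H"
      using \<epsilon> by (simp add: L2_norm_def real_sqrt_mult)
    finally show "in_L2 (restrict_space lborel ?S) (commutator (rescale \<epsilon> V1) \<rho> \<phi>) \<and>
        L2_norm (restrict_space lborel ?S) (commutator (rescale \<epsilon> V1) \<rho> \<phi>)
        \<le> \<epsilon> * sqrt m * L2_norm (restrict_space lborel {0..T})
            (\<lambda>t. Linf_norm lborel (hess (\<lambda>x. \<phi> (t, x))))"
      using C_meas int by (simp add: in_L2_def k_def H_def[abs_def])
  qed
qed

end
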